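(* Let $S$ be a semigroup. Functions $f,g:S\to\mathbb{C}$ satisfy $$f(xy)=f(x)g(y)+g(x)f(y)-g(x)g(y),\quad x,y\in S,$$ if and only if the pair $(f,g)$ has one of the following forms: (1) $f$ is a function such that $f(xy)=0$ for all $x,y\in S$, and $g=0$. (2) $f$ is a non-zero function such that $f(xy)=0$ for all $x,y\in S$, and $g=2f$. (3) $f=\frac{\alpha^2}{2\alpha-1}\chi$ and $g=\alpha\chi$, where $\chi:S\to\mathbb{C}$ is a non-zero multiplicative function and $\alpha\in\mathbb{C}\setminus\{0,\frac12\}$ is a constant. (4) $f=\frac{\chi_1+\chi_2}{2}+\frac{\beta^2+1}{2\beta}\,\frac{\chi_1-\chi_2}{2}$ and $g=\frac{\chi_1+\chi_2}{2}+\beta\,\frac{\chi_1-\chi_2}{2}$, where $\chi_1,\chi_2:S\to\mathbb{C}$ are two different multiplicative functions and $\beta\in\mathbb{C}\setminus\{0\}$ is a constant. (5) $f=\frac12\varphi+\chi$ and $g=\varphi+\chi$, where $\chi:S\to\mathbb{C}$ is a non-zero multiplicative function and $\varphi:S\to\mathbb{C}$ is a non-zero function satisfying $\varphi(xy)=\varphi(x)\chi(y)+\chi(x)\varphi(y)$ for all $x,y\in S$. (6) $f=\varphi+\chi$ and $g=\chi$, where $\chi:S\to\mathbb{C}$ is a non-zero multiplicative function and $\varphi:S\to\mathbb{C}$ is a non-zero function satisfying $\varphi(xy)=\varphi(x)\chi(y)+\chi(x)\varphi(y)$ for all $x,y\in S$.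
   Context: A semigroup is a set with an associative composition. A multiplicative function on $S$ is a function $\chi:S\to\mathbb{C}$ with $\chi(xy)=\chi(x)\chi(y)$ for all $x,y\in S$; the zero function is allowed unless stated otherwise. A function is non-zero if it is not identically zero. *)

theory Defs
  imports Complex_Main
begin

text \<open>The zero function counts as multiplicative.\<close>

definition multiplicative_fun :: "('a::semigroup_mult \<Rightarrow> complex) \<Rightarrow> bool" where
  "multiplicative_fun \<chi> \<longleftrightarrow> (\<forall>x y. \<chi> (x * y) = \<chi> x * \<chi> y)"

definition nonzero_fun :: "('a \<Rightarrow> complex) \<Rightarrow> bool" where
  "nonzero_fun f \<longleftrightarrow> (\<exists>x. f x \<noteq> 0)"

end

theory Submission
  imports Defs
begin

text \<open>
  Put \<open>k = f - g\<close>. Expanding \<open>f\<close> at a triple product in two ways gives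
  \<open>D x y * k z = k x * D y z\<close> for the defect \<open>D x y = g (x * y) - g x * g y\<close>. If \<open>k\<close> is non-zero,
  this forces \<open>D x y = c * k x * k y\<close> for a constant \<open>c\<close>. Then \<open>g + \<lambda> k\<close> is multiplicative
  whenever \<open>\<lambda>\<^sup>2 + c \<lambda> - c = 0\<close>. Two distinct roots give form (4); the double root
  \<open>\<lambda> = 0\<close> (\<open>c = 0\<close>) gives form (6) or (1), the double root \<open>\<lambda> = 2\<close> (\<open>c = -4\<close>) gives form (5) or (2).
  If \<open>k = 0\<close>, then \<open>f = g\<close> is multiplicative, which is form (3) with \<open>\<alpha> = 1\<close>, or (1).
\<close>

section \<open>The defect of \<open>g\<close> and multiplicative combinations of \<open>f\<close>
  and \<open>g\<close>\<close>

text \<open>Exchanging against \<open>z\<^sub>0\<close> pulls a factor \<open>k x\<close> out of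
  \<open>D x y\<close> and leaves \<open>D y z\<^sub>0\<close>; a second exchange pulls out
  \<open>k y\<close>.\<close>

lemma defect_rank_one:
  fixes D :: "'a \<Rightarrow> 'a \<Rightarrow> 'b::field" and k :: "'a \<Rightarrow> 'b"
  assumes "\<And>x y z. D x y * k z = k x * D y z" and "k z\<^sub>0 \<noteq> 0"
  obtains c where "\<And>x y. D x y = c * k x * k y"
proof
  fix x y
  have "D x y * k z\<^sub>0 = k x * D y z\<^sub>0" and "D y z\<^sub>0 * k z\<^sub>0 = k y * D z\<^sub>0 z\<^sub>0"
    by (rule assms(1))+
  then show "D x y = D z\<^sub>0 z\<^sub>0 / (k z\<^sub>0)\<^sup>2 * k x * k y"
    using assms(2) by (simp add: field_simps power2_eq_square)
qed

text \<open>The Vieta form keeps multiplicity: a double root appears as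
  \<open>r = s\<close>.\<close>

lemma quadratic_roots_complex:
  fixes b c :: complex
  obtains r s where "r + s = - b" and "r * s = c"
proof
  let ?w = "csqrt (b\<^sup>2 - 4 * c)"
  show "(- b + ?w) / 2 + (- b - ?w) / 2 = - b"
    by (simp add: field_simps)
  have "(- b + ?w) / 2 * ((- b - ?w) / 2) = (b\<^sup>2 - ?w\<^sup>2) / 4"
    by (simp add: algebra_simps power2_eq_square)
  then show "(- b + ?w) / 2 * ((- b - ?w) / 2) = c"
    by simp
qed

context
  fixes f g :: "'a::semigroup_mult \<Rightarrow> complex"
  assumes eqn: "\<And>x y. f (x * y) = f x * g y + g x * f y - g x * g y"
begin

lemma defect_exchange:
  "(g (x * y) - g x * g y) * (f z - g z) = (f x - g x) * (g (y * z) - g y * g z)"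
proof -
  have "f (x * y) * g z + g (x * y) * f z - g (x * y) * g z
      = f x * g (y * z) + g x * f (y * z) - g x * g (y * z)"
    using eqn[of "x * y" z] eqn[of x "y * z"] by (simp add: mult.assoc)
  then show ?thesis
    \<comment> \<open>The term \<open>g x * f y * g z\<close> occurs on both sides and
      cancels.\<close>
    unfolding eqn[of x y] eqn[of y z] by algebra
qed

lemma mult_defect:
  assumes "f z\<^sub>0 \<noteq> g z\<^sub>0"
  obtains c where "\<And>x y. g (x * y) = g x * g y + c * (f x - g x) * (f y - g y)"
proof -
  obtain c where "\<And>x y. g (x * y) - g x * g y = c * (f x - g x) * (f y - g y)"
    using defect_rank_one[of "\<lambda>x y. g (x * y) - g x * g y" "\<lambda>x. f x - g x" z\<^sub>0]
      defect_exchange assms by auto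
  then show thesis
    using that by (metis add.commute diff_add_cancel)
qed

text \<open>With \<open>k = f - g\<close>, the equation gives
  \<open>k (x * y) = k x * g y + g x * k y - c * k x * k y\<close>. Multiplicativity of
  \<open>g + l * k\<close> thus only requires the coefficients of \<open>k x * k y\<close> to agree:
  \<open>c - l * c = l\<^sup>2\<close>.\<close>

lemma multiplicative_shift:
  assumes "\<And>x y. g (x * y) = g x * g y + c * (f x - g x) * (f y - g y)"
    and "l\<^sup>2 + c * l - c = 0"
  shows "multiplicative_fun (\<lambda>x. g x + l * (f x - g x))"
  unfolding multiplicative_fun_def
proof (intro allI)
  fix x y
  show "g (x * y) + l * (f (x * y) - g (x * y)) = (g x + l * (f x - g x)) * (g y + l * (f y - g y))"
    unfolding eqn assms(1) using assms(2) by algebra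
qed

end

text \<open>With \<open>k = f - g\<close>, inverting the linear system gives \<open>g\<close> and
  \<open>f = g + k\<close> as the mean of the two functions plus \<open>c / (r - s)\<close>,
  respectively \<open>(c + 2) / (r - s)\<close>, times their half-difference. The discriminant
  \<open>c\<^sup>2 + 4 * c\<close> links these two coefficients.\<close>

lemma distinct_roots_form:
  fixes f g :: "'a \<Rightarrow> 'b::field_char_0"
  assumes "r \<noteq> s" and rs: "r + s = - c" "r * s = - c"
  defines "\<chi>\<^sub>1 \<equiv> \<lambda>x. g x + r * (f x - g x)" and "\<chi>\<^sub>2 \<equiv> \<lambda>x. g x + s * (f x - g x)"
    and "\<beta> \<equiv> c / (r - s)"
  shows "\<beta> \<noteq> 0"
    and "f x = (\<chi>\<^sub>1 x + \<chi>\<^sub>2 x) / 2 + (\<beta>\<^sup>2 + 1) / (2 * \<beta>) * ((\<chi>\<^sub>1 x - \<chi>\<^sub>2 x) / 2)"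
    and "g x = (\<chi>\<^sub>1 x + \<chi>\<^sub>2 x) / 2 + \<beta> * ((\<chi>\<^sub>1 x - \<chi>\<^sub>2 x) / 2)"
proof -
  \<comment> \<open>If \<open>c = 0\<close>, both roots would vanish and coincide.\<close>
  have d: "r - s \<noteq> 0" and c: "c \<noteq> 0"
    using assms(1) rs by auto
  then show \<beta>: "\<beta> \<noteq> 0"
    by (simp add: \<beta>_def)
  have diff: "\<chi>\<^sub>1 x - \<chi>\<^sub>2 x = (r - s) * (f x - g x)"
    and sum: "\<chi>\<^sub>1 x + \<chi>\<^sub>2 x = 2 * g x - c * (f x - g x)"
    using rs(1) unfolding \<chi>\<^sub>1_def \<chi>\<^sub>2_def by - algebra+
  have c_eq: "\<beta> * (r - s) = c"
    using d by (simp add: \<beta>_def)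
  then show "g x = (\<chi>\<^sub>1 x + \<chi>\<^sub>2 x) / 2 + \<beta> * ((\<chi>\<^sub>1 x - \<chi>\<^sub>2 x) / 2)"
    unfolding diff sum by (simp add: field_simps) algebra
  have disc: "(r - s)\<^sup>2 = c\<^sup>2 + 4 * c"
    using rs by algebra
  define \<gamma> where "\<gamma> = (\<beta>\<^sup>2 + 1) / (2 * \<beta>)"
  have \<gamma>: "2 * \<beta> * \<gamma> = \<beta>\<^sup>2 + 1"
    using \<beta> by (simp add: \<gamma>_def)
  \<comment> \<open>The goal \<open>\<gamma> * (r - s) = c + 2\<close> is proved after
    multiplication by \<open>2 * c\<close>.\<close>
  have "2 * c * (\<gamma> * (r - s)) = (2 * \<beta> * \<gamma>) * (r - s)\<^sup>2"
    unfolding c_eq[symmetric] by (simp add: power2_eq_square)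
  also have "\<dots> = (\<beta> * (r - s))\<^sup>2 + (r - s)\<^sup>2"
    unfolding \<gamma> by algebra
  also have "\<dots> = 2 * c * (c + 2)"
    unfolding c_eq disc by algebra
  finally have "2 * c * (\<gamma> * (r - s)) = 2 * c * (c + 2)" .
  with c have "\<gamma> * (r - s) = c + 2"
    by simp
  then have "\<gamma> * ((r - s) * (f x - g x) / 2) = (c + 2) * (f x - g x) / 2"
    by (metis mult.assoc times_divide_eq_right)
  then show "f x = (\<chi>\<^sub>1 x + \<chi>\<^sub>2 x) / 2 + (\<beta>\<^sup>2 + 1) / (2 * \<beta>) * ((\<chi>\<^sub>1 x - \<chi>\<^sub>2 x) / 2)"
    unfolding diff sum \<gamma>_def[symmetric] by (simp add: field_simps)
qed

section \<open>Verification of forms (3) to (6)\<close>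

text \<open>Treats forms (5) and (6) together: \<open>2 * a * b = b\<^sup>2\<close> is the vanishing
  of the coefficient of \<open>\<phi> x * \<phi> y\<close>.\<close>

lemma sine_pair_solution:
  fixes \<chi> \<phi> :: "'a::semigroup_mult \<Rightarrow> complex"
  assumes "multiplicative_fun \<chi>" and "\<And>x y. \<phi> (x * y) = \<phi> x * \<chi> y + \<chi> x * \<phi> y"
    and "\<And>x. f x = a * \<phi> x + \<chi> x" and "\<And>x. g x = b * \<phi> x + \<chi> x" and "2 * a * b = b\<^sup>2"
  shows "f (x * y) = f x * g y + g x * f y - g x * g y"
proof -
  have "\<chi> (x * y) = \<chi> x * \<chi> y"
    using assms(1) by (simp add: multiplicative_fun_def)
  with assms(5) show ?thesis
    unfolding assms(2-4) by algebra
qed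

text \<open>The relation \<open>2 * \<beta> * \<gamma> = \<beta>\<^sup>2 + 1\<close> is exactly what
  cancels the mixed products of \<open>\<chi>\<^sub>1\<close> and
  \<open>\<chi>\<^sub>2\<close>.\<close>

lemma two_characters_solution:
  fixes \<chi>\<^sub>1 \<chi>\<^sub>2 :: "'a::semigroup_mult \<Rightarrow> complex"
  assumes "multiplicative_fun \<chi>\<^sub>1" "multiplicative_fun \<chi>\<^sub>2" "\<beta> \<noteq> 0"
    and f: "\<And>x. f x = (\<chi>\<^sub>1 x + \<chi>\<^sub>2 x) / 2 + (\<beta>\<^sup>2 + 1) / (2 * \<beta>) * ((\<chi>\<^sub>1 x - \<chi>\<^sub>2 x) / 2)"
    and g: "\<And>x. g x = (\<chi>\<^sub>1 x + \<chi>\<^sub>2 x) / 2 + \<beta> * ((\<chi>\<^sub>1 x - \<chi>\<^sub>2 x) / 2)"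
  shows "f (x * y) = f x * g y + g x * f y - g x * g y"
proof -
  define \<gamma> where "\<gamma> = (\<beta>\<^sup>2 + 1) / (2 * \<beta>)"
  have \<gamma>: "2 * \<beta> * \<gamma> = \<beta>\<^sup>2 + 1"
    using assms(3) by (simp add: \<gamma>_def)
  have "\<chi>\<^sub>1 (x * y) = \<chi>\<^sub>1 x * \<chi>\<^sub>1 y" "\<chi>\<^sub>2 (x * y) = \<chi>\<^sub>2 x * \<chi>\<^sub>2 y"
    using assms(1,2) by (simp_all add: multiplicative_fun_def)
  moreover have "2 * f t = \<chi>\<^sub>1 t + \<chi>\<^sub>2 t + \<gamma> * (\<chi>\<^sub>1 t - \<chi>\<^sub>2 t)"
    and "2 * g t = \<chi>\<^sub>1 t + \<chi>\<^sub>2 t + \<beta> * (\<chi>\<^sub>1 t - \<chi>\<^sub>2 t)" for t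
    unfolding f g \<gamma>_def[symmetric] by (simp_all add: field_simps)
  note this[of x] this[of y] this[of "x * y"]
  ultimately have "4 * f (x * y) = 4 * (f x * g y + g x * f y - g x * g y)"
    using \<gamma> by algebra
  then show ?thesis
    by (metis mult_left_cancel zero_neq_numeral)
qed

text \<open>Comparing coefficients of \<open>\<chi> x * \<chi> y\<close> leaves
  \<open>\<gamma> = 2 * \<alpha> * \<gamma> - \<alpha>\<^sup>2\<close> for the factor
  \<open>\<gamma>\<close> of \<open>f\<close>.\<close>

lemma scaled_character_solution:
  fixes \<chi> :: "'a::semigroup_mult \<Rightarrow> complex"
  assumes "multiplicative_fun \<chi>" "\<alpha> \<noteq> 1 / 2"
    and f: "\<And>x. f x = \<alpha>\<^sup>2 / (2 * \<alpha> - 1) * \<chi> x" and g: "\<And>x. g x = \<alpha> * \<chi> x"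
  shows "f (x * y) = f x * g y + g x * f y - g x * g y"
proof -
  define \<gamma> where "\<gamma> = \<alpha>\<^sup>2 / (2 * \<alpha> - 1)"
  have "2 * \<alpha> - 1 \<noteq> 0"
    using assms(2) by (auto simp: field_simps)
  then have "\<gamma> * (2 * \<alpha> - 1) = \<alpha>\<^sup>2"
    by (simp add: \<gamma>_def)
  moreover have "\<chi> (x * y) = \<chi> x * \<chi> y"
    using assms(1) by (simp add: multiplicative_fun_def)
  ultimately show ?thesis
    unfolding f g \<gamma>_def[symmetric] by algebra
qed

section \<open>Classification of the solutions\<close>

theorem corollary5p1:
  fixes f g :: "'a::semigroup_mult \<Rightarrow> complex"
  shows "(\<forall>x y. f (x * y) = f x * g y + g x * f y - g x * g y) \<longleftrightarrow>
    ((\<forall>x y. f (x * y) = 0) \<and> (\<forall>x. g x = 0)) \<or>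
    (nonzero_fun f \<and> (\<forall>x y. f (x * y) = 0) \<and> (\<forall>x. g x = 2 * f x)) \<or>
    (\<exists>(\<chi> :: 'a \<Rightarrow> complex) (\<alpha> :: complex).
       multiplicative_fun \<chi> \<and> nonzero_fun \<chi> \<and> \<alpha> \<noteq> 0 \<and> \<alpha> \<noteq> 1 / 2 \<and>
       (\<forall>x. f x = \<alpha>\<^sup>2 / (2 * \<alpha> - 1) * \<chi> x) \<and> (\<forall>x. g x = \<alpha> * \<chi> x)) \<or>
    (\<exists>(\<chi>\<^sub>1 :: 'a \<Rightarrow> complex) (\<chi>\<^sub>2 :: 'a \<Rightarrow> complex) (\<beta> :: complex).
       multiplicative_fun \<chi>\<^sub>1 \<and> multiplicative_fun \<chi>\<^sub>2 \<and> \<chi>\<^sub>1 \<noteq> \<chi>\<^sub>2 \<and> \<beta> \<noteq> 0 \<and>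
       (\<forall>x. f x = (\<chi>\<^sub>1 x + \<chi>\<^sub>2 x) / 2 + (\<beta>\<^sup>2 + 1) / (2 * \<beta>) * ((\<chi>\<^sub>1 x - \<chi>\<^sub>2 x) / 2)) \<and>
       (\<forall>x. g x = (\<chi>\<^sub>1 x + \<chi>\<^sub>2 x) / 2 + \<beta> * ((\<chi>\<^sub>1 x - \<chi>\<^sub>2 x) / 2))) \<or>
    (\<exists>(\<chi> :: 'a \<Rightarrow> complex) (\<phi> :: 'a \<Rightarrow> complex).
       multiplicative_fun \<chi> \<and> nonzero_fun \<chi> \<and> nonzero_fun \<phi> \<and>
       (\<forall>x y. \<phi> (x * y) = \<phi> x * \<chi> y + \<chi> x * \<phi> y) \<and>
       (\<forall>x. f x = 1 / 2 * \<phi> x + \<chi> x) \<and> (\<forall>x. g x = \<phi> x + \<chi> x)) \<or>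
    (\<exists>(\<chi> :: 'a \<Rightarrow> complex) (\<phi> :: 'a \<Rightarrow> complex).
       multiplicative_fun \<chi> \<and> nonzero_fun \<chi> \<and> nonzero_fun \<phi> \<and>
       (\<forall>x y. \<phi> (x * y) = \<phi> x * \<chi> y + \<chi> x * \<phi> y) \<and>
       (\<forall>x. f x = \<phi> x + \<chi> x) \<and> (\<forall>x. g x = \<chi> x))"
  (is "?E \<longleftrightarrow> ?F1 \<or> ?F2 \<or> ?F3 \<or> ?F4 \<or> ?F5 \<or> ?F6")
proof
  assume E: ?E
  then have eqn: "\<And>x y. f (x * y) = f x * g y + g x * f y - g x * g y"
    by blast
  show "?F1 \<or> ?F2 \<or> ?F3 \<or> ?F4 \<or> ?F5 \<or> ?F6"
  \<comment> \<open>Splitting off \<open>g = 0\<close> first lets \<open>g\<close> itself serve as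
    the non-zero character in forms (3) and (6).\<close>
  proof (cases "\<forall>x. g x = 0")
    case True
    then have ?F1
      using eqn by simp
    then show ?thesis ..
  next
    case False
    then have g_nz: "nonzero_fun g"
      by (simp add: nonzero_fun_def)
    show ?thesis
    proof (cases "\<forall>x. f x = g x")
      case True
      then have "multiplicative_fun g"
        using eqn by (simp add: multiplicative_fun_def)
      then have ?F3
        using True g_nz by (intro exI[of _ g] exI[of _ 1]) simp
      then show ?thesis
        by blast
    next
      case False
      then obtain z where z: "f z \<noteq> g z"
        by blast
      obtain c where c: "\<And>x y. g (x * y) = g x * g y + c * (f x - g x) * (f y - g y)"
        using mult_defect[OF eqn z] by blast
      obtain r s where rs: "r + s = - c" "r * s = - c"
        by (rule quadratic_roots_complex)
      have "r\<^sup>2 + c * r - c = 0" "s\<^sup>2 + c * s - c = 0"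
        using rs by - algebra+
      note mult = this[THEN multiplicative_shift[OF eqn c]]
      show ?thesis
      proof (cases "r = s")
        case False
        \<comment> \<open>At \<open>z\<close> the two functions differ by
          \<open>(r - s) * (f z - g z)\<close>.\<close>
        have "(\<lambda>x. g x + r * (f x - g x)) \<noteq> (\<lambda>x. g x + s * (f x - g x))"
          using False z by (auto dest: fun_cong[of _ _ z])
        then have ?F4
          using mult distinct_roots_form(1)[OF False rs]
              distinct_roots_form(2,3)[OF False rs, where f = f and g = g]
            by blast
        then show ?thesis
          by blast
      next
        case True
        \<comment> \<open>For \<open>r = s\<close> the Vieta relations read
          \<open>2 * r = - c = r\<^sup>2\<close>, so only 0 and 2 remain.\<close>
        then have c_r: "c = - 2 * r"
          using rs(1) by (simp add: eq_neg_iff_add_eq_0 add.commute)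
        then have "r * (r - 2) = 0"
          using rs(2) True by (simp add: algebra_simps)
        then consider "r = 0" | "r = 2"
          by auto
        then show ?thesis
        proof cases
          case 1
          then have "multiplicative_fun g"
            using mult(1) by simp
          moreover have "f (x * y) - g (x * y) = (f x - g x) * g y + g x * (f y - g y)" for x y
            using 1 c_r by (simp add: eqn c algebra_simps)
          moreover have "nonzero_fun (\<lambda>x. f x - g x)"
            using z by (auto simp: nonzero_fun_def)
          ultimately have ?F6
            using g_nz by (intro exI[of _ g] exI[of _ "\<lambda>x. f x - g x"]) simp
          then show ?thesis
            by blast
        next
          case 2
          \<comment> \<open>\<open>\<chi>\<close> is the shift by the double root;
            \<open>\<phi>\<close> is then forced to be \<open>g - \<chi>\<close>.\<close>
          define \<chi> where "\<chi> = (\<lambda>x. g x + 2 * (f x - g x))"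
          define \<phi> where "\<phi> = (\<lambda>x. 2 * (g x - f x))"
          have \<chi>: "multiplicative_fun \<chi>"
            using mult(1) 2 by (simp add: \<chi>_def)
          have \<phi>: "\<phi> (x * y) = \<phi> x * \<chi> y + \<chi> x * \<phi> y" for x y
            using 2 c_r by (simp add: \<phi>_def \<chi>_def eqn c algebra_simps)
          have fg: "f x = 1 / 2 * \<phi> x + \<chi> x" "g x = \<phi> x + \<chi> x" for x
            by (simp_all add: \<phi>_def \<chi>_def diff_divide_distrib)
          have nz: "nonzero_fun \<phi>"
            using z[symmetric] by (auto simp: nonzero_fun_def \<phi>_def)
          show ?thesis
          proof (cases "nonzero_fun \<chi>")
            case True
            then have ?F5
              using \<chi> \<phi> fg nz by blast
            then show ?thesis
              by blast
          next
            case False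
            \<comment> \<open>With \<open>\<chi> = 0\<close> the sine addition law makes
              \<open>\<phi>\<close> vanish on products, and
              \<open>g = \<phi> = 2 * f\<close>.\<close>
            then have "\<chi> x = 0" for x
              by (simp add: nonzero_fun_def)
            then have "\<phi> (x * y) = 0" "\<phi> x = 2 * f x" "g x = \<phi> x" for x y
              using \<phi> fg by (simp_all add: mult.commute)
            then have ?F2
              using nz by (simp add: nonzero_fun_def)
            then show ?thesis
              by blast
          qed
        qed
      qed
    qed
  qed
next
  assume "?F1 \<or> ?F2 \<or> ?F3 \<or> ?F4 \<or> ?F5 \<or> ?F6"
  then show ?E
  proof (elim disjE)
    assume ?F1
    then show ?E
      by simp
  next
    \<comment> \<open>For \<open>g = 2 * f\<close> the right-hand side is
      \<open>(2 + 2 - 4) * f x * f y = 0\<close>.\<close>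
    assume ?F2
    then show ?E
      by simp
  next
    assume ?F3
    then show ?E
      using scaled_character_solution[of _ _ f g] by blast
  next
    assume ?F4
    then show ?E
      using two_characters_solution[of _ _ _ f g] by blast
  next
    assume ?F5
    then show ?E
      using sine_pair_solution[of _ _ f "1 / 2" g 1] by auto
  next
    assume ?F6
    then show ?E
      using sine_pair_solution[of _ _ f 1 g 0] by auto
  qed
qed

end
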